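(* (i) Every self-orthogonal linear Kleinian code $C$ is equivalent to a code $D\oplus\gamma_1^{l}$ for some $l\ge 0$, where $D$ is a self-orthogonal code containing no codeword of weight $1$. (ii) Every self-orthogonal linear Kleinian code that is generated (as a group) by its codewords of weight $2$ is equivalent to a direct sum of codes each of which is $\delta_l$ for some $l\ge 2$ or $\epsilon_2$, together with the zero code on the coordinates at which all codewords vanish.
   Context: Let $K=\{0,a,b,c\}$ be the Kleinian four-group. A linear code of length $n$ is a subgroup of $K^n$; $\mathrm{wt}(\mathbf{x})$ is the number of nonzero coordinates. Define $x\cdot y\in\mathbb{F}_2$ for $x,y\in K$ by $x\cdot y=1$ iff $x,y$ are nonzero and distinct; $(\mathbf{x},\mathbf{y})=\sum_ix_i\cdot y_i$; $C^\perp=\{\mathbf{x}:(\mathbf{x},\mathbf{y})=0\ \forall \mathbf{y}\in C\}$; $C$ is self-orthogonal if $C\subseteq C^\perp$. The direct sum $C\oplus D$ of codes $C\subseteq K^n$, $D\subseteq K^m$ is $C\times D\subseteq K^{n+m}$. The group $G=S_3^n\rtimes S_n$ acts on $K^n$ by permuting coordinates and independently permuting the three nonzero symbols $a,b,c$ in each coordinate; codes $C,D$ are equivalent if $gC=D$ for some $g\in G$. Here $\gamma_1=\{(0),(a)\}\subseteq K$, $\epsilon_2=\{(0,0),(a,a),(b,b),(c,c)\}\subseteq K^2$, and $\delta_l\subseteq K^l$ is the code of all words with all entries in $\{0,a\}$ and an even number of entries equal to $a$. *)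

theory Defs
  imports
    Main
    "HOL-Library.Z2"
    "HOL-Library.Product_Plus"
    "HOL-Combinatorics.Permutations"
    "HOL-Algebra.Generated_Groups"
begin

type_synonym klein = "bit \<times> bit"

abbreviation klein_a :: klein where "klein_a \<equiv> (1, 0)"
abbreviation klein_b :: klein where "klein_b \<equiv> (0, 1)"
abbreviation klein_c :: klein where "klein_c \<equiv> (1, 1)"

text \<open>The group \<open>K^n\<close>, with words represented as lists of length \<open>n\<close>.\<close>

definition klein_space :: "nat \<Rightarrow> klein list monoid" where
  "klein_space n =
     \<lparr>carrier = {x. length x = n}, mult = map2 (+), one = replicate n 0\<rparr>"

lemma comm_group_klein_space: "comm_group (klein_space n)"
proof (rule comm_groupI)
  fix x assume x: "x \<in> carrier (klein_space n)"
  then have "map uminus x \<otimes>\<^bsub>klein_space n\<^esub> x = \<one>\<^bsub>klein_space n\<^esub>"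
    by (auto simp: klein_space_def intro!: nth_equalityI)
  with x show "\<exists>y\<in>carrier (klein_space n). y \<otimes>\<^bsub>klein_space n\<^esub> x = \<one>\<^bsub>klein_space n\<^esub>"
    by (intro bexI[of _ "map uminus x"]) (auto simp: klein_space_def)
qed (auto simp: klein_space_def add.assoc add.commute intro!: nth_equalityI)

definition linear_code :: "nat \<Rightarrow> klein list set \<Rightarrow> bool" where
  "linear_code n C \<longleftrightarrow> subgroup C (klein_space n)"

definition wt :: "klein list \<Rightarrow> nat" where
  "wt x = card {i. i < length x \<and> x ! i \<noteq> 0}"

definition klein_dot :: "klein \<Rightarrow> klein \<Rightarrow> bit" where
  "klein_dot x y = of_bool (x \<noteq> 0 \<and> y \<noteq> 0 \<and> x \<noteq> y)"

definition inner_prod :: "nat \<Rightarrow> klein list \<Rightarrow> klein list \<Rightarrow> bit" where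
  "inner_prod n x y = (\<Sum>i<n. klein_dot (x ! i) (y ! i))"

definition dual_code :: "nat \<Rightarrow> klein list set \<Rightarrow> klein list set" where
  "dual_code n C = {x \<in> carrier (klein_space n). \<forall>y\<in>C. inner_prod n x y = 0}"

definition self_orthogonal :: "nat \<Rightarrow> klein list set \<Rightarrow> bool" where
  "self_orthogonal n C \<longleftrightarrow> C \<subseteq> dual_code n C"

definition direct_sum :: "klein list set \<Rightarrow> klein list set \<Rightarrow> klein list set" where
  "direct_sum C D = {x @ y | x y. x \<in> C \<and> y \<in> D}"

text \<open>The empty direct sum is \<open>K^0\<close>, whose only word is the empty list.\<close>

definition direct_sums :: "klein list set list \<Rightarrow> klein list set" where
  "direct_sums Cs = foldr direct_sum Cs {[]}"

text \<open>A pair \<open>(\<pi>, \<sigma>)\<close> stands for an element of \<open>S\<^sub>3^n \<rtimes> S\<^sub>n\<close>: \<open>\<sigma>\<close> permutes the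
  coordinates, and \<open>\<pi> i\<close> (which fixes 0) permutes the nonzero symbols in coordinate \<open>i\<close>.\<close>

definition code_group :: "nat \<Rightarrow> ((nat \<Rightarrow> klein \<Rightarrow> klein) \<times> (nat \<Rightarrow> nat)) set" where
  "code_group n =
     {(\<pi>, \<sigma>). (\<forall>i<n. \<pi> i permutes {klein_a, klein_b, klein_c}) \<and> \<sigma> permutes {..<n}}"

definition act ::
  "nat \<Rightarrow> (nat \<Rightarrow> klein \<Rightarrow> klein) \<times> (nat \<Rightarrow> nat) \<Rightarrow> klein list \<Rightarrow> klein list" where
  "act n g x = map (\<lambda>i. fst g i (x ! snd g i)) [0..<n]"

definition equivalent_codes :: "nat \<Rightarrow> klein list set \<Rightarrow> klein list set \<Rightarrow> bool" where
  "equivalent_codes n C D \<longleftrightarrow> (\<exists>g\<in>code_group n. act n g ` C = D)"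

definition gamma1 :: "klein list set" where
  "gamma1 = {[0], [klein_a]}"

definition epsilon2 :: "klein list set" where
  "epsilon2 = {[0, 0], [klein_a, klein_a], [klein_b, klein_b], [klein_c, klein_c]}"

definition delta :: "nat \<Rightarrow> klein list set" where
  "delta l = {x. length x = l \<and> set x \<subseteq> {0, klein_a} \<and>
                 even (card {i. i < l \<and> x ! i = klein_a})}"

definition zero_code :: "nat \<Rightarrow> klein list set" where
  "zero_code n = {replicate n 0}"

definition vanishing_coords :: "nat \<Rightarrow> klein list set \<Rightarrow> nat set" where
  "vanishing_coords n C = {i. i < n \<and> (\<forall>x\<in>C. x ! i = 0)}"

end

theory Submission
  imports Defs
begin

text \<open>A word of weight 1 in a self-orthogonal code forces all codewords to be 0 or its symbol at
  its coordinate, so the code splits off a factor \<open>\<gamma>\<^sub>1\<close> there. For words of weight 2,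
  orthogonality forces two of them whose supports meet in a single coordinate to carry the same
  symbol in it. Hence being joined by a word of weight 2 is a transitive relation between
  coordinates. If two different symbols occur at a coordinate, its class has just two elements and
  gives \<open>\<epsilon>\<^sub>2\<close>; otherwise every coordinate of the class has a single symbol, which is
  renamed to \<open>a\<close>, and the class gives a \<open>\<delta>\<^sub>l\<close>.\<close>

subsection \<open>The Kleinian four-group\<close>

lemma klein_cases: "x = 0 \<or> x = klein_a \<or> x = klein_b \<or> x = klein_c" for x :: klein
  by (cases x; cases "fst x"; cases "snd x") (auto simp: zero_prod_def)

lemma klein_add_self [simp]: "x + x = 0" for x :: klein
  using klein_cases[of x] by (auto simp: zero_prod_def)

lemma klein_add_eq_0_iff: "x + y = 0 \<longleftrightarrow> x = y" for x y :: klein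
  by (metis add_right_imp_eq klein_add_self)

lemma klein_add_self_left [simp]: "x + (x + y) = y" for x y :: klein
  by (simp flip: add.assoc)

lemma klein_third_symbol:
  fixes u v w :: klein
  assumes "u \<noteq> 0" "v \<noteq> 0" "w \<noteq> 0" "u \<noteq> v" "w \<noteq> u" "w \<noteq> v"
  shows "w = u + v"
  using assms klein_cases[of u] klein_cases[of v] klein_cases[of w]
  by (auto simp: zero_prod_def)

lemma klein_dot_eq_0_iff: "klein_dot x y = 0 \<longleftrightarrow> x = 0 \<or> y = 0 \<or> x = y"
  by (auto simp: klein_dot_def)

lemma klein_symbols: "{klein_a, klein_b, klein_c} = - {0}"
  using klein_cases by (auto simp: zero_prod_def)

lemma permutes_symbols_0:
  assumes "\<tau> permutes {klein_a, klein_b, klein_c}"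
  shows "\<tau> 0 = 0"
  using permutes_not_in[OF assms, of 0] by (simp add: zero_prod_def)

lemma ex_symbol_permutation:
  fixes s :: klein
  assumes "s \<noteq> 0"
  shows "\<exists>\<tau>. \<tau> permutes {klein_a, klein_b, klein_c} \<and> \<tau> s = klein_a"
  using assms
  by (intro exI[of _ "transpose s klein_a"] conjI permutes_swap_id)
     (auto simp: klein_symbols zero_prod_def)

text \<open>After a permutation sending \<open>s\<close> to a, a transposition moves the image of
  \<open>t\<close> to b. It fixes a, since that image is neither 0 nor a.\<close>

lemma ex_symbol_permutation2:
  fixes s t :: klein
  assumes "s \<noteq> 0" "t \<noteq> 0" "s \<noteq> t"
  shows "\<exists>\<tau>. \<tau> permutes {klein_a, klein_b, klein_c} \<and> \<tau> s = klein_a \<and> \<tau> t = klein_b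
    \<and> \<tau> (s + t) = klein_c"
proof -
  obtain f where f: "f permutes {klein_a, klein_b, klein_c}" "f s = klein_a"
    using ex_symbol_permutation[OF assms(1)] by blast
  define g where "g = transpose (f t) klein_b \<circ> f"
  have ft: "f t \<noteq> 0" "f t \<noteq> klein_a"
    using assms permutes_inj[OF f(1)] f(2) permutes_symbols_0[OF f(1)] by (metis injD)+
  have g: "g permutes {klein_a, klein_b, klein_c}"
    unfolding g_def using f ft
    by (intro permutes_compose permutes_swap_id) (auto simp: klein_symbols zero_prod_def)
  have gs: "g s = klein_a" "g t = klein_b"
    using f(2) ft by (auto simp: g_def transpose_def)
  have "s + t \<noteq> s" "s + t \<noteq> t" "s + t \<noteq> 0"
    using assms by (auto simp: klein_add_eq_0_iff)
  then have "g (s + t) \<noteq> klein_a" "g (s + t) \<noteq> klein_b" "g (s + t) \<noteq> 0"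
    using permutes_inj[OF g] gs permutes_symbols_0[OF g] by (metis injD)+
  then have "g (s + t) = klein_c"
    using klein_cases[of "g (s + t)"] by auto
  with g gs show ?thesis by blast
qed

text \<open>The size of the symmetric difference is \<open>card X + card Y\<close> minus twice the
  size of the intersection. It serves for supports of sums when each coordinate has a single
  symbol.\<close>

lemma even_card_symmetric_difference:
  assumes "finite X" "finite Y" "even (card X)" "even (card Y)"
  shows "even (card ((X \<union> Y) - (X \<inter> Y)))"
proof -
  have "X \<union> Y - X \<inter> Y = (X - X \<inter> Y) \<union> (Y - X \<inter> Y)"
    by blast
  then have "card (X \<union> Y - X \<inter> Y) = card (X - X \<inter> Y) + card (Y - X \<inter> Y)"
    using assms by (simp only:) (rule card_Un_disjoint, auto)
  moreover have "card X = card (X - X \<inter> Y) + card (X \<inter> Y)"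
    using assms card_Int_Diff[of X Y] by (simp add: Diff_Int)
  moreover have "card Y = card (Y - X \<inter> Y) + card (X \<inter> Y)"
    using assms card_Int_Diff[of Y X] by (simp add: Diff_Int Int_commute)
  ultimately show ?thesis
    using assms(3,4) by simp
qed

subsection \<open>Codes that decompose along coordinate sets\<close>

definition supp :: "klein list \<Rightarrow> nat set" where
  "supp x = {i. i < length x \<and> x ! i \<noteq> 0}"

lemma wt_eq_card_supp: "wt x = card (supp x)"
  by (simp add: wt_def supp_def)

lemma inv_klein_space:
  assumes "length x = n"
  shows "inv\<^bsub>klein_space n\<^esub> x = x"
proof -
  interpret comm_group "klein_space n" by (rule comm_group_klein_space)
  show ?thesis
    using assms
    by (intro inv_equality) (auto simp: klein_space_def intro!: nth_equalityI)
qed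

text \<open>A set containing 0 and closed under addition is a subgroup here because every word is
  its own inverse.\<close>

lemma linear_code_iff:
  "linear_code n C \<longleftrightarrow>
     (\<forall>x\<in>C. length x = n) \<and> replicate n 0 \<in> C \<and> (\<forall>x\<in>C. \<forall>y\<in>C. map2 (+) x y \<in> C)"
proof -
  interpret comm_group "klein_space n" by (rule comm_group_klein_space)
  show ?thesis
  proof
    assume "linear_code n C"
    then interpret subgroup C "klein_space n" by (simp add: linear_code_def)
    show "(\<forall>x\<in>C. length x = n) \<and> replicate n 0 \<in> C \<and> (\<forall>x\<in>C. \<forall>y\<in>C. map2 (+) x y \<in> C)"
      using subset one_closed m_closed by (auto simp: klein_space_def)
  next
    assume C: "(\<forall>x\<in>C. length x = n) \<and> replicate n 0 \<in> C \<and> (\<forall>x\<in>C. \<forall>y\<in>C. map2 (+) x y \<in> C)"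
    then show "linear_code n C"
      unfolding linear_code_def
      by (intro subgroupI) (auto simp: inv_klein_space, auto simp: klein_space_def)
  qed
qed

text \<open>The inverse rule of \<open>generate\<close> collapses, each word being its own inverse.
  The ambient code \<open>C\<close> makes membership, and with it the length of words, available in
  the sum case.\<close>

lemma generate_klein_induct [consumes 3, case_names zero base add]:
  assumes "x \<in> generate (klein_space n) H" and "H \<subseteq> C" and "linear_code n C"
    and "P (replicate n 0)"
    and "\<And>x. x \<in> H \<Longrightarrow> P x"
    and "\<And>x y. x \<in> C \<Longrightarrow> y \<in> C \<Longrightarrow> P x \<Longrightarrow> P y \<Longrightarrow> P (map2 (+) x y)"
  shows "P x"
proof -
  have "x \<in> C \<and> P x"
    using assms(1)
  proof (induction rule: generate.induct)
    case one
    then show ?case using assms(3,4) by (simp add: klein_space_def linear_code_iff)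
  next
    case (incl h)
    then show ?case using assms by blast
  next
    case (inv h)
    then have "inv\<^bsub>klein_space n\<^esub> h = h"
      using assms(2,3) by (intro inv_klein_space) (auto simp: linear_code_iff)
    then show ?case using inv assms by auto
  next
    case (eng h1 h2)
    then show ?case using assms(3,6) by (auto simp: klein_space_def linear_code_iff)
  qed
  then show ?thesis ..
qed

section \<open>Gluing codewords along a set of coordinates\<close>

definition merge :: "nat set \<Rightarrow> klein list \<Rightarrow> klein list \<Rightarrow> klein list" where
  "merge A x y = map (\<lambda>i. if i \<in> A then x ! i else y ! i) [0..<length x]"

text \<open>For a linear code: it is the product of its restrictions to \<open>A\<close> and to the
  complement, said without renumbering coordinates. The set \<open>A\<close> may reach beyond the
  length of the words, so complements can be taken in all natural numbers.\<close>

definition splits :: "klein list set \<Rightarrow> nat set \<Rightarrow> bool" where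
  "splits C A \<longleftrightarrow> (\<forall>x\<in>C. \<forall>y\<in>C. merge A x y \<in> C)"

lemma length_merge [simp]: "length (merge A x y) = length x"
  by (simp add: merge_def)

lemma nth_merge [simp]: "i < length x \<Longrightarrow> merge A x y ! i = (if i \<in> A then x ! i else y ! i)"
  by (simp add: merge_def)

text \<open>The glued word is the truncation of \<open>x + y\<close> to \<open>A\<close>, plus
  \<open>y\<close>: on \<open>A\<close> the two copies of \<open>y\<close> cancel. So closure under
  truncation suffices.\<close>

lemma splitsI:
  assumes "linear_code n C" and "\<And>x. x \<in> C \<Longrightarrow> merge A x (replicate n 0) \<in> C"
  shows "splits C A"
  unfolding splits_def
proof (intro ballI)
  fix x y assume xy: "x \<in> C" "y \<in> C"
  then have len: "length x = n" "length y = n"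
    using assms(1) by (auto simp: linear_code_iff)
  have "merge A x y = map2 (+) (merge A (map2 (+) x y) (replicate n 0)) y"
    using len by (intro nth_equalityI) (auto simp: add.assoc)
  then show "merge A x y \<in> C"
    using assms xy by (simp add: linear_code_iff)
qed

lemma splits_Compl:
  assumes "linear_code n C" and "splits C A"
  shows "splits C (- A)"
  unfolding splits_def
proof (intro ballI)
  fix x y assume xy: "x \<in> C" "y \<in> C"
  then have "merge (- A) x y = merge A y x"
    using assms(1) by (intro nth_equalityI) (auto simp: linear_code_iff)
  then show "merge (- A) x y \<in> C"
    using assms xy by (simp add: splits_def)
qed

lemma splits_Un:
  assumes "splits C A" and "splits C B"
  shows "splits C (A \<union> B)"
  unfolding splits_def
proof (intro ballI)
  fix x y assume xy: "x \<in> C" "y \<in> C"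
  have "merge (A \<union> B) x y = merge A x (merge B x y)"
    by (intro nth_equalityI) auto
  then show "merge (A \<union> B) x y \<in> C"
    using assms xy by (simp add: splits_def)
qed

lemma splits_UN:
  assumes "finite I" and "\<And>i. i \<in> I \<Longrightarrow> splits C (A i)" and "linear_code n C"
  shows "splits C (\<Union>i\<in>I. A i)"
  using assms
proof (induction rule: finite_induct)
  case empty
  have "merge {} x y = y" if "x \<in> C" "y \<in> C" for x y
    using that empty(2) by (intro nth_equalityI) (auto simp: linear_code_iff)
  then show ?case by (simp add: splits_def)
qed (simp add: splits_Un)

text \<open>\<open>\<tau>\<close> is indexed by the old coordinate, so one family of renamings
  serves every list \<open>p\<close>. If \<open>p\<close> enumerates all coordinates once, this is
  the action of a group element; a shorter \<open>p\<close> gives a restriction of the word.\<close>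

definition proj :: "(nat \<Rightarrow> klein \<Rightarrow> klein) \<Rightarrow> nat list \<Rightarrow> klein list \<Rightarrow> klein list" where
  "proj \<tau> p x = map (\<lambda>j. \<tau> j (x ! j)) p"

lemma proj_append: "proj \<tau> (p @ q) x = proj \<tau> p x @ proj \<tau> q x"
  by (simp add: proj_def)

lemma proj_cong: "(\<And>j. j \<in> set p \<Longrightarrow> \<tau> j (x ! j) = \<tau>' j (y ! j)) \<Longrightarrow> proj \<tau> p x = proj \<tau>' p y"
  by (simp add: proj_def)

text \<open>The enumeration \<open>p\<close> itself is the coordinate permutation. In
  \<open>act\<close> the symbol permutation is indexed by the new position \<open>i\<close>, hence
  the family \<open>\<tau> (p ! i)\<close>.\<close>

lemma equivalent_codes_proj:
  assumes p: "distinct p" "set p = {..<n}"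
    and \<tau>: "\<And>j. j < n \<Longrightarrow> \<tau> j permutes {klein_a, klein_b, klein_c}"
  shows "equivalent_codes n C (proj \<tau> p ` C)"
proof -
  have len: "length p = n"
    using p distinct_card by fastforce
  \<comment> \<open>The identity outside \<open>{..<n}\<close> is what \<open>permutes\<close>
    requires.\<close>
  define \<sigma> where "\<sigma> i = (if i < n then p ! i else i)" for i
  have "bij_betw ((!) p) {..<n} {..<n}"
    by (rule bij_betw_nth[OF p(1)]) (simp_all add: p(2) len)
  also have "?this \<longleftrightarrow> bij_betw \<sigma> {..<n} {..<n}"
    by (rule bij_betw_cong) (simp add: \<sigma>_def)
  finally have "bij_betw \<sigma> {..<n} {..<n}" .
  then have "\<sigma> permutes {..<n}"
    by (rule bij_imp_permutes) (simp add: \<sigma>_def)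
  moreover have "\<tau> (p ! i) permutes {klein_a, klein_b, klein_c}" if "i < n" for i
    using \<tau> p(2) len that nth_mem by blast
  ultimately have "(\<lambda>i. \<tau> (p ! i), \<sigma>) \<in> code_group n"
    by (simp add: code_group_def)
  moreover have "act n (\<lambda>i. \<tau> (p ! i), \<sigma>) = proj \<tau> p"
    using len by (auto simp: act_def proj_def \<sigma>_def intro!: nth_equalityI)
  ultimately show ?thesis
    unfolding equivalent_codes_def by (metis (no_types))
qed

text \<open>A word of the direct sum comes from two codewords; gluing them along
  \<open>set p\<close> gives one codeword with both projections, as the lists are disjoint.\<close>

lemma proj_append_image:
  assumes C: "linear_code n C" and split: "splits C (set p)"
    and pq: "set p \<inter> set q = {}" "set p \<subseteq> {..<n}" "set q \<subseteq> {..<n}"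
  shows "proj \<tau> (p @ q) ` C = direct_sum (proj \<tau> p ` C) (proj \<tau> q ` C)"
proof (intro equalityI subsetI)
  fix z assume "z \<in> direct_sum (proj \<tau> p ` C) (proj \<tau> q ` C)"
  then obtain x y where xy: "x \<in> C" "y \<in> C" "z = proj \<tau> p x @ proj \<tau> q y"
    by (auto simp: direct_sum_def)
  then have "length x = n"
    using C by (simp add: linear_code_iff)
  then have "proj \<tau> p x = proj \<tau> p (merge (set p) x y)" "proj \<tau> q y = proj \<tau> q (merge (set p) x y)"
    using pq by (auto simp: subset_iff disjoint_iff intro!: proj_cong)
  then show "z \<in> proj \<tau> (p @ q) ` C"
    using xy split by (auto simp: proj_append splits_def)
qed (auto simp: direct_sum_def proj_append)

lemma proj_concat_image:
  assumes C: "linear_code n C"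
    and "\<And>p. p \<in> set ps \<Longrightarrow> splits C (set p)"
    and "\<And>p. p \<in> set ps \<Longrightarrow> set p \<subseteq> {..<n}"
    and "distinct (concat ps)"
  shows "proj \<tau> (concat ps) ` C = direct_sums (map (\<lambda>p. proj \<tau> p ` C) ps)"
  using assms(2-)
proof (induction ps)
  case Nil
  have "C \<noteq> {}" using C by (auto simp: linear_code_iff)
  then show ?case by (auto simp: direct_sums_def proj_def)
next
  case (Cons p ps)
  have "proj \<tau> (p @ concat ps) ` C = direct_sum (proj \<tau> p ` C) (proj \<tau> (concat ps) ` C)"
    using Cons.prems by (intro proj_append_image[OF C]) auto
  with Cons show ?case by (simp add: direct_sums_def)
qed

lemma inner_prod_supp:
  assumes "finite A" "supp x \<subseteq> A" "A \<subseteq> {..<n}" "length x = n"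
  shows "inner_prod n x y = (\<Sum>i\<in>A. klein_dot (x ! i) (y ! i))"
  unfolding inner_prod_def using assms
  by (intro sum.mono_neutral_right) (auto simp: supp_def klein_dot_def)

lemma self_orthogonalD:
  "self_orthogonal n C \<Longrightarrow> x \<in> C \<Longrightarrow> y \<in> C \<Longrightarrow> inner_prod n x y = 0"
  by (auto simp: self_orthogonal_def dual_code_def)

subsection \<open>Words of weight 1\<close>

text \<open>Only the term at \<open>i\<close> survives in the inner product with \<open>u\<close>,
  and a nonzero symbol is orthogonal to 0 and itself alone.\<close>

lemma weight_one_coordinate:
  assumes C: "linear_code n C" and orth: "self_orthogonal n C"
    and u: "u \<in> C" "supp u = {i}" and x: "x \<in> C"
  shows "x ! i = 0 \<or> x ! i = u ! i"
proof -
  have len: "length u = n" using C u by (simp add: linear_code_iff)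
  have i: "i < n" "u ! i \<noteq> 0" using u(2) len by (auto simp: supp_def)
  have "inner_prod n u x = klein_dot (u ! i) (x ! i)"
    using inner_prod_supp[of "{i}" u n x] i u len by simp
  then show ?thesis
    using self_orthogonalD[OF orth u(1) x] i by (auto simp: klein_dot_eq_0_iff)
qed

text \<open>The set \<open>S\<close> collects the coordinates that support a codeword of weight 1.
  Each yields a factor \<open>gamma1\<close>, and \<open>D\<close> is the restriction to the other
  coordinates.\<close>

lemma split_off_gamma1:
  assumes C: "linear_code n C" and orth: "self_orthogonal n C"
  shows "\<exists>m l D. m + l = n \<and> linear_code m D \<and> self_orthogonal m D \<and>
            (\<forall>x\<in>D. wt x \<noteq> 1) \<and>
            equivalent_codes n C (direct_sum D (direct_sums (replicate l gamma1)))"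
proof -
  have len: "length x = n" if "x \<in> C" for x
    using C that by (simp add: linear_code_iff)
  define S where "S = {i. \<exists>x\<in>C. supp x = {i}}"
  have S: "S \<subseteq> {..<n}" using len by (auto simp: S_def supp_def)
  then have finS: "finite S" using finite_subset by blast
  have "\<forall>i\<in>S. \<exists>v. v \<in> C \<and> supp v = {i}"
    by (auto simp: S_def)
  then obtain u where u: "\<And>i. i \<in> S \<Longrightarrow> u i \<in> C \<and> supp (u i) = {i}"
    by metis
  have u_nz: "u i ! i \<noteq> 0" if "i \<in> S" for i
    using u[OF that] by (auto simp: supp_def)
  have coord: "x ! i = 0 \<or> x ! i = u i ! i" if "i \<in> S" "x \<in> C" for i x
    using weight_one_coordinate[OF C orth] u that by blast
  have split1: "splits C {i}" if i: "i \<in> S" for i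
  proof (rule splitsI[OF C])
    fix x assume x: "x \<in> C"
    have "u i ! j = 0" if "j < n" "j \<noteq> i" for j
      using u[OF i] len that by (auto simp: supp_def)
    \<comment> \<open>By \<open>coord\<close> the truncation of \<open>x\<close> to coordinate
      \<open>i\<close> has only two possible values, both of them codewords.\<close>
    then have "merge {i} x (replicate n 0) = (if x ! i = 0 then replicate n 0 else u i)"
      using coord[OF i x] len[OF x] len u[OF i] by (auto intro!: nth_equalityI)
    then show "merge {i} x (replicate n 0) \<in> C"
      using C u[OF i] by (auto simp: linear_code_iff)
  qed
  have splitS: "splits C S"
    using splits_UN[of S C "\<lambda>i. {i}"] finS split1 C by simp
  define q where "q = sorted_list_of_set ({..<n} - S)"
  define r where "r = sorted_list_of_set S"
  have q: "distinct q" "set q = {..<n} - S" and r: "distinct r" "set r = S"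
    using finS by (simp_all add: q_def r_def)
  define m where "m = length q"
  define l where "l = length r"
  have q_less: "q ! k < n" if "k < m" for k
    using that q(2) nth_mem[of k q] by (auto simp: m_def)
  have mn: "bij_betw ((!) q) {..<m} ({..<n} - S)"
    by (rule bij_betw_nth[OF q(1)]) (auto simp: q m_def)
  have ml: "m + l = n"
    using distinct_card[of "q @ r"] q r S by (auto simp: m_def l_def Un_absorb1 Un_absorb2)
  have "\<forall>i\<in>S. \<exists>t. t permutes {klein_a, klein_b, klein_c} \<and> t (u i ! i) = klein_a"
    using ex_symbol_permutation u_nz by blast
  then obtain t where t: "\<And>i. i \<in> S \<Longrightarrow> t i permutes {klein_a, klein_b, klein_c}"
      "\<And>i. i \<in> S \<Longrightarrow> t i (u i ! i) = klein_a"
    by metis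
  \<comment> \<open>Nothing is renamed off \<open>S\<close>, so \<open>D\<close> is the plain
    restriction of \<open>C\<close> to the coordinates in \<open>q\<close>.\<close>
  define \<tau> where "\<tau> i = (if i \<in> S then t i else id)" for i
  have \<tau>: "\<tau> i permutes {klein_a, klein_b, klein_c}" for i
    using t permutes_id by (auto simp: \<tau>_def)
  define D where "D = proj \<tau> q ` C"
  have proj_q: "proj \<tau> q x = map ((!) x) q" for x
    using q by (auto simp: proj_def \<tau>_def)
  \<comment> \<open>As the code splits along \<open>S\<close>, erasing the entries on
    \<open>S\<close> stays in \<open>C\<close>. This lifts words of \<open>D\<close> to codewords
    with the same nonzero entries.\<close>
  define rest where "rest x = merge (- S) x (replicate n 0)" for x
  have rest: "rest x \<in> C" if "x \<in> C" for x
    using splits_Compl[OF C splitS] C that by (auto simp: splits_def rest_def linear_code_iff)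
  have supp_rest: "supp (rest x) = {i \<in> {..<n} - S. x ! i \<noteq> 0}" if "x \<in> C" for x
    using len[OF that] by (auto simp: rest_def supp_def split: if_splits)
  have "linear_code m D"
    unfolding linear_code_iff
  proof (intro conjI ballI)
    show "length x = m" if "x \<in> D" for x
      using that by (auto simp: D_def proj_q m_def)
    have "map ((!) (replicate n 0)) q = replicate m 0"
      by (intro nth_equalityI) (use q_less in \<open>auto simp: m_def\<close>)
    then show "replicate m 0 \<in> D"
      using C unfolding D_def linear_code_iff by (metis image_iff proj_q)
    fix x y assume "x \<in> D" "y \<in> D"
    then obtain x' y' where xy: "x' \<in> C" "y' \<in> C" "x = map ((!) x') q" "y = map ((!) y') q"
      by (auto simp: D_def proj_q)
    have "map2 (+) x y = map ((!) (map2 (+) x' y')) q"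
      by (intro nth_equalityI) (use q_less len xy in \<open>auto simp: m_def\<close>)
    then show "map2 (+) x y \<in> D"
      using C xy unfolding D_def linear_code_iff by (metis image_iff proj_q)
  qed
  moreover have "self_orthogonal m D"
  proof -
    have "inner_prod m x y = 0" if D: "x \<in> D" "y \<in> D" for x y
    proof -
      obtain x' y' where xy: "x' \<in> C" "y' \<in> C" "x = map ((!) x') q" "y = map ((!) y') q"
        using D by (auto simp: D_def proj_q)
      have "inner_prod m x y = (\<Sum>k<m. klein_dot (x' ! (q ! k)) (y' ! (q ! k)))"
        by (simp add: inner_prod_def xy m_def)
      also have "\<dots> = (\<Sum>i\<in>{..<n} - S. klein_dot (x' ! i) (y' ! i))"
        using sum.reindex_bij_betw[OF mn, of "\<lambda>i. klein_dot (x' ! i) (y' ! i)"] .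
      \<comment> \<open>Off \<open>S\<close> the word \<open>rest x'\<close> agrees with
        \<open>x'\<close>, and it vanishes on \<open>S\<close>; so the partial sum becomes a full
        inner product of two codewords.\<close>
      also have "\<dots> = (\<Sum>i\<in>{..<n} - S. klein_dot (rest x' ! i) (y' ! i))"
        using len[OF xy(1)] by (simp add: rest_def)
      also have "\<dots> = inner_prod n (rest x') y'"
        using supp_rest[OF xy(1)] len[OF rest[OF xy(1)]]
        by (intro inner_prod_supp[symmetric]) auto
      finally show ?thesis
        using self_orthogonalD[OF orth rest[OF xy(1)] xy(2)] by simp
    qed
    then show ?thesis
      using \<open>linear_code m D\<close>
      by (auto simp: self_orthogonal_def dual_code_def linear_code_iff klein_space_def)
  qed
  moreover have "wt x \<noteq> 1" if D: "x \<in> D" for x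
  proof
    \<comment> \<open>Lifted by \<open>rest\<close>, a word of weight 1 in \<open>D\<close> keeps
      weight 1 and is supported outside \<open>S\<close>, against the choice of
      \<open>S\<close>.\<close>
    assume wt: "wt x = 1"
    obtain x' where x': "x' \<in> C" "x = map ((!) x') q"
      using D by (auto simp: D_def proj_q)
    have "(!) q ` supp x = {i \<in> (!) q ` {..<m}. x' ! i \<noteq> 0}"
      by (auto simp: supp_def x' m_def)
    also have "\<dots> = supp (rest x')"
      by (simp add: supp_rest[OF x'(1)] bij_betw_imp_surj_on[OF mn])
    finally have "bij_betw ((!) q) (supp x) (supp (rest x'))"
      by (intro bij_betw_subset[OF mn]) (auto simp: supp_def x' m_def)
    then have "card (supp (rest x')) = 1"
      using wt bij_betw_same_card by (metis wt_eq_card_supp)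
    then obtain i where i: "supp (rest x') = {i}"
      by (auto simp: card_1_singleton_iff)
    then have "i \<in> S" using rest[OF x'(1)] by (auto simp: S_def)
    moreover have "i \<notin> S" using i supp_rest[OF x'(1)] by auto
    ultimately show False by simp
  qed
  moreover have "equivalent_codes n C (direct_sum D (direct_sums (replicate l gamma1)))"
  proof -
    have "proj \<tau> [i] ` C = gamma1" if i: "i \<in> S" for i
    proof -
      \<comment> \<open>The symbol 0 occurs in the zero word and \<open>u i ! i\<close> in
        \<open>u i\<close>; \<open>coord\<close> excludes any other.\<close>
      have "(\<lambda>x. x ! i) ` C = {0, u i ! i}"
      proof
        show "{0, u i ! i} \<subseteq> (\<lambda>x. x ! i) ` C"
          using u[OF i] C i S by (force simp: linear_code_iff image_iff)
      qed (use coord[OF i] in blast)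
      then have "(\<lambda>x. [\<tau> i x]) ` (\<lambda>x. x ! i) ` C = {[\<tau> i 0], [\<tau> i (u i ! i)]}"
        by (simp only: image_insert image_empty)
      then show ?thesis
        using t(2)[OF i] i permutes_symbols_0[OF t(1)[OF i]]
        by (simp add: image_image proj_def gamma1_def \<tau>_def)
    qed
    then have "map (\<lambda>p. proj \<tau> p ` C) (map (\<lambda>i. [i]) r) = replicate l gamma1"
      using r by (simp add: l_def flip: map_replicate_const)
    moreover have "proj \<tau> (concat (map (\<lambda>i. [i]) r)) ` C
        = direct_sums (map (\<lambda>p. proj \<tau> p ` C) (map (\<lambda>i. [i]) r))"
      using split1 S r by (intro proj_concat_image[OF C]) auto
    ultimately have "proj \<tau> r ` C = direct_sums (replicate l gamma1)"
      by simp
    \<comment> \<open>The entries of \<open>q\<close> form the complement of \<open>S\<close> below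
      \<open>n\<close>; words of length \<open>n\<close> do not see the difference from
      \<open>- S\<close>.\<close>
    moreover have "splits C ({..<n} - S)"
    proof -
      have "merge ({..<n} - S) x y = merge (- S) x y" if "x \<in> C" for x y
        using len[OF that] by (intro nth_equalityI) auto
      then show ?thesis
        using splits_Compl[OF C splitS] by (simp add: splits_def)
    qed
    then have "proj \<tau> (q @ r) ` C = direct_sum (proj \<tau> q ` C) (proj \<tau> r ` C)"
      using q r S by (intro proj_append_image[OF C]) auto
    moreover have "equivalent_codes n C (proj \<tau> (q @ r) ` C)"
      using q r S \<tau> by (intro equivalent_codes_proj) auto
    ultimately show ?thesis by (simp add: D_def)
  qed
  ultimately show ?thesis using ml by blast
qed

subsection \<open>Words of weight 2\<close>

locale self_orthogonal_code =
  fixes n :: nat and C :: "klein list set"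
  assumes linear: "linear_code n C" and orth: "self_orthogonal n C"
begin

lemma length_codeword: "x \<in> C \<Longrightarrow> length x = n"
  using linear by (simp add: linear_code_iff)

lemma add_codeword: "x \<in> C \<Longrightarrow> y \<in> C \<Longrightarrow> map2 (+) x y \<in> C"
  using linear by (simp add: linear_code_iff)

lemma zero_codeword: "replicate n 0 \<in> C"
  using linear by (simp add: linear_code_iff)

lemma nth_add_codeword: "x \<in> C \<Longrightarrow> y \<in> C \<Longrightarrow> i < n \<Longrightarrow> map2 (+) x y ! i = x ! i + y ! i"
  by (simp add: length_codeword)

lemma supp_less: "x \<in> C \<Longrightarrow> i \<in> supp x \<Longrightarrow> i < n"
  by (simp add: supp_def length_codeword)

lemma nth_supp: "i \<in> supp x \<Longrightarrow> x ! i \<noteq> 0"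
  by (simp add: supp_def)

lemma nth_not_supp: "x \<in> C \<Longrightarrow> i < n \<Longrightarrow> i \<notin> supp x \<Longrightarrow> x ! i = 0"
  by (simp add: supp_def length_codeword)

text \<open>Only \<open>i\<close> and \<open>j\<close> contribute to the inner product, and two bits
  add to 0 exactly if they agree.\<close>

lemma dot_weight_two:
  assumes "u \<in> C" "v \<in> C" "supp u = {i, j}" "i \<noteq> j"
  shows "klein_dot (u ! i) (v ! i) = klein_dot (u ! j) (v ! j)"
proof -
  have "inner_prod n u v = klein_dot (u ! i) (v ! i) + klein_dot (u ! j) (v ! j)"
    using inner_prod_supp[of "{i, j}" u n v] assms supp_less[of u] length_codeword by auto
  then have "klein_dot (u ! i) (v ! i) + klein_dot (u ! j) (v ! j) = 0"
    using self_orthogonalD[OF orth] assms by simp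
  then show ?thesis by (cases "klein_dot (u ! i) (v ! i)"; cases "klein_dot (u ! j) (v ! j)") auto
qed

text \<open>The word \<open>v\<close> vanishes at \<open>j\<close>, so the product at
  \<open>j\<close> is 0. Hence so is the product at \<open>i\<close>, where both symbols are
  nonzero.\<close>

lemma same_symbol:
  assumes "u \<in> C" "v \<in> C" "supp u = {i, j}" "supp v = {i, k}" "i \<noteq> j" "i \<noteq> k" "j \<noteq> k"
  shows "u ! i = v ! i"
proof -
  have "v ! j = 0"
    using assms supp_less[of u j] by (intro nth_not_supp) auto
  then show ?thesis
    using dot_weight_two[OF assms(1-3,5)] nth_supp[of i u] nth_supp[of i v] assms
    by (auto simp: klein_dot_def split: if_splits)
qed

text \<open>The inequality keeps a word of weight 1 from joining \<open>i\<close> to itself. The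
  relation is thus irreflexive, which is why transitivity carries
  \<open>i \<noteq> k\<close>.\<close>

definition joined :: "nat \<Rightarrow> nat \<Rightarrow> bool" where
  "joined i j \<longleftrightarrow> i \<noteq> j \<and> (\<exists>u\<in>C. supp u = {i, j})"

lemma joined_sym: "joined i j \<Longrightarrow> joined j i"
  by (auto simp: joined_def insert_commute)

text \<open>Weight-2 words whose supports meet in one coordinate carry the same symbol there, so
  their sum has weight 2 again.\<close>

lemma joined_trans:
  assumes "joined i j" "joined j k" "i \<noteq> k"
  shows "joined i k"
proof -
  obtain u v where u: "u \<in> C" "supp u = {j, i}" "j \<noteq> i" and v: "v \<in> C" "supp v = {j, k}" "j \<noteq> k"
    using assms by (auto simp: joined_def insert_commute)
  have ujvj: "u ! j = v ! j"
    using same_symbol u v assms(3) by blast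
  define w where "w = map2 (+) u v"
  have w: "w \<in> C" using add_codeword u v by (simp add: w_def)
  have "w ! m \<noteq> 0 \<longleftrightarrow> m = i \<or> m = k" if m: "m < n" for m
  proof -
    have "u ! m \<noteq> 0 \<longleftrightarrow> m = i \<or> m = j" "v ! m \<noteq> 0 \<longleftrightarrow> m = j \<or> m = k"
      using u v m by (metis insert_iff empty_iff nth_supp nth_not_supp)+
    then have "u ! m + v ! m \<noteq> 0 \<longleftrightarrow> m = i \<or> m = k"
      using u(3) v(3) assms(3) ujvj
      by (cases "m = j"; cases "m = i"; cases "m = k") simp_all
    then show ?thesis
      by (simp only: w_def nth_add_codeword[OF u(1) v(1) m])
  qed
  moreover have "i < n" "k < n"
    using supp_less u v by auto
  ultimately have "supp w = {i, k}"
    using length_codeword[OF w] by (auto simp: supp_def)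
  then show ?thesis
    using w assms(3) by (auto simp: joined_def)
qed

definition block :: "nat \<Rightarrow> nat set" where
  "block i = insert i {j. joined i j}"

text \<open>For a code generated by its words of weight 2 these are exactly the coordinates at which
  some codeword is nonzero.\<close>

definition covered :: "nat set" where
  "covered = {i. \<exists>j. joined i j}"

lemma joined_less: "joined i j \<Longrightarrow> i < n"
  using supp_less by (fastforce simp: joined_def)

lemma covered_subset: "covered \<subseteq> {..<n}"
  using joined_less by (auto simp: covered_def)

text \<open>The reflexive closure of \<open>joined\<close> is an equivalence relation, and the
  blocks are its classes.\<close>

lemma block_eq:
  assumes "j \<in> block i"
  shows "block j = block i"
  using assms joined_sym joined_trans unfolding block_def by blast

lemma block_subset_covered: "i \<in> covered \<Longrightarrow> block i \<subseteq> covered"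
  using joined_sym by (auto simp: covered_def block_def)

end

section \<open>Codes generated by their words of weight 2\<close>

locale weight_two_code = self_orthogonal_code +
  assumes generated: "C = generate (klein_space n) {x \<in> C. wt x = 2}"
begin

lemma codeword_induct [consumes 1, case_names zero pair add]:
  assumes "x \<in> C" and "P (replicate n 0)"
    and "\<And>x i j. x \<in> C \<Longrightarrow> supp x = {i, j} \<Longrightarrow> i \<noteq> j \<Longrightarrow> P x"
    and "\<And>x y. x \<in> C \<Longrightarrow> y \<in> C \<Longrightarrow> P x \<Longrightarrow> P y \<Longrightarrow> P (map2 (+) x y)"
  shows "P x"
proof -
  have "x \<in> generate (klein_space n) {x \<in> C. wt x = 2}"
    using assms(1) generated by blast
  moreover have "{x \<in> C. wt x = 2} \<subseteq> C" by blast
  ultimately show ?thesis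
    using linear
  proof (induction rule: generate_klein_induct)
    case zero
    show ?case by (rule assms(2))
  next
    case (base x)
    then show ?case using assms(3) by (auto simp: wt_eq_card_supp card_2_iff)
  qed (rule assms(4))
qed

text \<open>A word of weight 2 has both coordinates in the same block, so truncation to a block
  keeps it whole or erases it; and truncation is additive.\<close>

lemma splits_block: "splits C (block i)"
proof (rule splitsI[OF linear])
  fix x assume "x \<in> C"
  then show "merge (block i) x (replicate n 0) \<in> C"
  proof (induction rule: codeword_induct)
    case zero
    have "merge (block i) (replicate n 0) (replicate n 0) = replicate n (0 :: klein)"
      by (intro nth_equalityI) auto
    then show ?case by (simp add: zero_codeword)
  next
    case (pair x j k)
    then have "joined j k" by (auto simp: joined_def)
    then have jk: "j \<in> block i \<longleftrightarrow> k \<in> block i"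
      using block_eq joined_sym unfolding block_def by blast
    have "x ! m = 0" if "m < n" "m \<noteq> j" "m \<noteq> k" for m
      using nth_not_supp[of x m] pair that by auto
    then have "merge (block i) x (replicate n 0) = (if j \<in> block i then x else replicate n 0)"
      using jk length_codeword[OF pair(1)] by (intro nth_equalityI) auto
    then show ?case using pair(1) zero_codeword by simp
  next
    case (add x y)
    have "merge (block i) (map2 (+) x y) (replicate n 0)
        = map2 (+) (merge (block i) x (replicate n 0)) (merge (block i) y (replicate n 0))"
      using add(1,2) length_codeword by (intro nth_equalityI) auto
    then show ?case using add by (simp add: add_codeword)
  qed
qed

lemma nth_uncovered:
  assumes "x \<in> C" "i < n" "i \<notin> covered"
  shows "x ! i = 0"
  using assms(1)
proof (induction rule: codeword_induct)
  case (pair x j k)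
  then have "joined j k" by (auto simp: joined_def)
  then have "j \<in> covered" "k \<in> covered" using joined_sym by (auto simp: covered_def)
  then have "i \<notin> supp x" using pair assms(3) by auto
  then show ?case using nth_not_supp pair(1) assms(2) by blast
qed (use assms(2) nth_add_codeword in auto)

lemma vanishing_coords_eq: "vanishing_coords n C = {..<n} - covered"
proof -
  have "\<exists>x\<in>C. x ! i \<noteq> 0" if "i \<in> covered" for i
    using that nth_supp[of i] by (fastforce simp: covered_def joined_def)
  then show ?thesis
    using nth_uncovered by (auto simp: vanishing_coords_def)
qed

text \<open>Two words of weight 2 with different symbols at \<open>j\<close> must have the same
  support, by \<open>same_symbol\<close>. The restriction of the code to this support is the group
  of order 4 generated by their restrictions.\<close>

lemma epsilon2_block:
  assumes u: "u \<in> C" "supp u = {j, k}" and v: "v \<in> C" "supp v = {j, l}"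
    and ne: "j \<noteq> k" "j \<noteq> l" "u ! j \<noteq> v ! j"
  shows "block j = {j, k} \<and> (\<exists>\<tau>. (\<forall>i. \<tau> i permutes {klein_a, klein_b, klein_c}) \<and>
           proj \<tau> [j, k] ` C = epsilon2)"
proof
  have "k = l" using same_symbol u v ne by blast
  note v = v[folded this]
  have jk: "j < n" "k < n" using u supp_less by auto
  have nz: "u ! j \<noteq> 0" "u ! k \<noteq> 0" "v ! j \<noteq> 0" "v ! k \<noteq> 0"
    using u(2) v(2) by (simp_all add: nth_supp)
  \<comment> \<open>The product of the symbols at \<open>j\<close> is 1, hence also the product at
    \<open>k\<close>.\<close>
  have nek: "u ! k \<noteq> v ! k"
    using dot_weight_two[OF u(1) v(1) u(2) ne(1)] nz ne(3) by (auto simp: klein_dot_def)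
  \<comment> \<open>A word joining \<open>j\<close> to a third coordinate would have to carry at
    \<open>j\<close> both the symbol of \<open>u\<close> and that of \<open>v\<close>.\<close>
  have m_eq: "m = k" if w: "w \<in> C" "supp w = {j, m}" "j \<noteq> m" for w m
  proof (rule ccontr)
    assume "m \<noteq> k"
    then have "u ! j = w ! j" "v ! j = w ! j"
      using same_symbol[of u w j k m] same_symbol[of v w j k m] u v w ne by auto
    then show False using ne by simp
  qed
  then show block: "block j = {j, k}"
    using m_eq u ne unfolding block_def joined_def by blast
  \<comment> \<open>The pairs of symbols that the four sums of \<open>u\<close> and \<open>v\<close>
    show at \<open>j\<close> and \<open>k\<close>.\<close>
  define W where "W = {(0, 0), (u ! j, u ! k), (v ! j, v ! k), (u ! j + v ! j, u ! k + v ! k)}"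
  have "(x ! j, x ! k) \<in> W" if "x \<in> C" for x
    using that
  proof (induction rule: codeword_induct)
    case zero
    then show ?case using jk by (simp add: W_def)
  next
    case (pair w a b)
    have joined: "joined a b" using pair by (auto simp: joined_def)
    show ?case
    proof (cases "a \<in> block j")
      case True
      then have "b \<in> block j"
        using joined block_eq unfolding block_def by blast
      then have "supp w = {j, k}"
        using pair True block by auto
      then have w: "w \<in> C" "w ! j \<noteq> 0" "w ! k \<noteq> 0"
        using pair(1) by (simp_all add: nth_supp)
      \<comment> \<open>Orthogonality to \<open>u\<close> and to \<open>v\<close> ties the symbol at
        \<open>j\<close> to the symbol at \<open>k\<close>.\<close>
      have *: "w ! j = u ! j \<longleftrightarrow> w ! k = u ! k" "w ! j = v ! j \<longleftrightarrow> w ! k = v ! k"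
        using dot_weight_two[OF u(1) w(1) u(2) ne(1)] dot_weight_two[OF v(1) w(1) v(2) ne(1)] nz w
        by (auto simp: klein_dot_def split: if_splits)
      show ?thesis
      proof (cases "w ! j = u ! j \<or> w ! j = v ! j")
        case True
        then show ?thesis using * by (auto simp: W_def)
      next
        case False
        \<comment> \<open>Different from \<open>u\<close> and \<open>v\<close> at both coordinates,
          \<open>w\<close> carries the third nonzero symbol there, the sum of the other two.\<close>
        then have "w ! j = u ! j + v ! j" "w ! k = u ! k + v ! k"
          using klein_third_symbol nz w ne(3) nek * by simp_all
        then show ?thesis by (simp add: W_def)
      qed
    next
      case False
      then have "b \<notin> block j"
        using joined_sym[OF joined] block_eq unfolding block_def by blast
      then have "j \<notin> supp w" "k \<notin> supp w"
        using False block pair by auto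
      then show ?thesis
        using nth_not_supp pair(1) jk by (simp add: W_def)
    qed
  next
    case (add x y)
    then show ?case
      using jk by (auto simp: W_def nth_add_codeword ac_simps)
  qed
  moreover have "W \<subseteq> (\<lambda>x. (x ! j, x ! k)) ` C"
  proof -
    let ?f = "\<lambda>x :: klein list. (x ! j, x ! k)"
    have "W = ?f ` {replicate n 0, u, v, map2 (+) u v}"
      using jk nth_add_codeword[OF u(1) v(1)] by (auto simp: W_def)
    also have "\<dots> \<subseteq> ?f ` C"
      using zero_codeword u(1) v(1) add_codeword by (intro image_mono) auto
    finally show ?thesis .
  qed
  ultimately have W: "(\<lambda>x. (x ! j, x ! k)) ` C = W" by blast
  \<comment> \<open>The two local renamings turn \<open>u\<close> into aa, \<open>v\<close> into bb
    and their sum into cc.\<close>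
  obtain \<tau>j \<tau>k where \<tau>:
    "\<tau>j permutes {klein_a, klein_b, klein_c}" "\<tau>j (u ! j) = klein_a" "\<tau>j (v ! j) = klein_b"
    "\<tau>j (u ! j + v ! j) = klein_c"
    "\<tau>k permutes {klein_a, klein_b, klein_c}" "\<tau>k (u ! k) = klein_a" "\<tau>k (v ! k) = klein_b"
    "\<tau>k (u ! k + v ! k) = klein_c"
    using ex_symbol_permutation2 nz ne(3) nek by meson
  define \<tau> where "\<tau> i = (if i = j then \<tau>j else \<tau>k)" for i
  have "proj \<tau> [j, k] ` C = (\<lambda>(x, y). [\<tau>j x, \<tau>k y]) ` (\<lambda>x. (x ! j, x ! k)) ` C"
    using ne(1) by (simp add: image_image proj_def \<tau>_def)
  also have "\<dots> = epsilon2"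
    unfolding W W_def epsilon2_def
    using \<tau> by (simp add: permutes_symbols_0)
  finally show "\<exists>\<tau>. (\<forall>i. \<tau> i permutes {klein_a, klein_b, klein_c}) \<and> proj \<tau> [j, k] ` C = epsilon2"
    using \<tau>(1,5) by (intro exI[of _ \<tau>]) (simp add: \<tau>_def)
qed

text \<open>With one symbol \<open>s j\<close> at each coordinate, sums of words of weight 2 keep
  the number of nonzero entries in the block even. Conversely, pairs through the fixed coordinate
  \<open>i\<close> add up to every even subset.\<close>

lemma delta_block:
  assumes i: "i \<in> covered"
    and nz: "\<And>j. j \<in> block i \<Longrightarrow> s j \<noteq> 0"
    and s: "\<And>j k u. j \<in> block i \<Longrightarrow> u \<in> C \<Longrightarrow> supp u = {j, k} \<Longrightarrow> j \<noteq> k \<Longrightarrow> u ! j = s j"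
    and p: "distinct p" "set p = block i"
    and \<tau>: "\<And>j. \<tau> j permutes {klein_a, klein_b, klein_c}" "\<And>j. j \<in> block i \<Longrightarrow> \<tau> j (s j) = klein_a"
  shows "proj \<tau> p ` C = delta (card (block i))"
proof -
  have block_less: "j < n" if "j \<in> block i" for j
    using block_subset_covered[OF i] covered_subset that by blast
  have fin: "finite (block i)" using p(2) by (metis List.finite_set)
  have i_block: "i \<in> block i" by (simp add: block_def)
  have len: "length p = card (block i)" using p distinct_card by fastforce
  have p_block: "p ! k \<in> block i" if "k < length p" for k
    using that p(2) nth_mem by blast
  have bij: "bij_betw ((!) p) {..<length p} (block i)"
    using bij_betw_nth[OF p(1)] p(2) by simp
  have inv: "(\<forall>j\<in>block i. x ! j = 0 \<or> x ! j = s j) \<and> even (card {j \<in> block i. x ! j \<noteq> 0})"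
    if "x \<in> C" for x
    using that
  proof (induction rule: codeword_induct)
    case zero
    have "replicate n (0 :: klein) ! j = 0" if "j \<in> block i" for j
      using block_less that by simp
    then show ?case by (simp cong: conj_cong)
  next
    case (pair w a b)
    have joined: "joined a b" using pair by (auto simp: joined_def)
    have *: "w ! j \<noteq> 0 \<longleftrightarrow> j \<in> supp w" if "j \<in> block i" for j
      using nth_supp nth_not_supp[OF pair(1)] block_less[OF that] by blast
    have ab: "a \<in> block i \<longleftrightarrow> b \<in> block i"
      using joined joined_sym[OF joined] block_eq unfolding block_def by blast
    have "{j \<in> block i. w ! j \<noteq> 0} = (if a \<in> block i then {a, b} else {})"
      using * pair(2) ab by auto
    then have "even (card {j \<in> block i. w ! j \<noteq> 0})"
      using pair(3) by simp
    moreover have "w ! a = s a" if "a \<in> block i"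
      using s[OF that pair] .
    moreover have "w ! b = s b" if "b \<in> block i"
      using s[OF that pair(1), of a] pair by (simp add: insert_commute)
    ultimately show ?case
      using * pair(2) by auto
  next
    case (add x y)
    define X where "X = {j \<in> block i. x ! j \<noteq> 0}"
    define Y where "Y = {j \<in> block i. y ! j \<noteq> 0}"
    have finXY: "finite X" "finite Y" using fin by (simp_all add: X_def Y_def)
    have nth: "map2 (+) x y ! j = x ! j + y ! j" if "j \<in> block i" for j
      using nth_add_codeword add block_less that by blast
    \<comment> \<open>Two entries from \<open>{0, s j}\<close> add to 0 exactly if they agree, so
      the support of the sum is the symmetric difference of the supports.\<close>
    have coords: "(map2 (+) x y ! j \<noteq> 0 \<longleftrightarrow> (x ! j \<noteq> 0) \<noteq> (y ! j \<noteq> 0)) \<and>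
        (map2 (+) x y ! j = 0 \<or> map2 (+) x y ! j = s j)" if "j \<in> block i" for j
    proof -
      have "x ! j = 0 \<or> x ! j = s j" "y ! j = 0 \<or> y ! j = s j"
        using add.IH that by blast+
      then show ?thesis
        using nz[OF that] by (elim disjE) (simp_all add: nth[OF that])
    qed
    then have "{j \<in> block i. map2 (+) x y ! j \<noteq> 0} = (X \<union> Y) - (X \<inter> Y)"
      by (auto simp: X_def Y_def)
    then have "even (card {j \<in> block i. map2 (+) x y ! j \<noteq> 0})"
      using even_card_symmetric_difference[OF finXY] add.IH by (simp add: X_def Y_def)
    then show ?case
      using coords by blast
  qed
  \<comment> \<open>On the block a codeword is determined by its support, so codewords are built
    from coordinate sets \<open>T\<close>.\<close>
  define word where "word T = map (\<lambda>j. if j \<in> T then s j else 0) [0..<n]" for T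
  have word_pair: "word {i, j} \<in> C" if j: "j \<in> block i" "j \<noteq> i" for j
  proof -
    obtain u where u: "u \<in> C" "supp u = {i, j}"
      using j by (auto simp: block_def joined_def)
    have "u ! m = (if m \<in> {i, j} then s m else 0)" if "m < n" for m
      using s[OF i_block u] s[OF j(1) u(1), of i] j(2) u(2) nth_not_supp[OF u(1) that]
      by (auto simp: insert_commute)
    then have "u = word {i, j}"
      using length_codeword[OF u(1)] by (intro nth_equalityI) (auto simp: word_def)
    then show ?thesis using u(1) by simp
  qed
  \<comment> \<open>An even set of coordinates is a sum of the pairs joining its elements to \<open>i\<close>.\<close>
  have star: "word (if odd (card T) then insert i T else T) \<in> C"
    if "finite T" "T \<subseteq> block i - {i}" for T
    using that
  proof (induction rule: finite_induct)
    case empty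
    have "word {} = replicate n 0"
      by (intro nth_equalityI) (auto simp: word_def)
    then show ?case by (simp add: zero_codeword)
  next
    case (insert j T)
    \<comment> \<open>Adding the pair \<open>{i, j}\<close> inserts \<open>j\<close> and toggles
      \<open>i\<close>, in step with the parity of \<open>card T\<close>.\<close>
    have "word (if odd (card (insert j T)) then insert i (insert j T) else insert j T)
        = map2 (+) (word (if odd (card T) then insert i T else T)) (word {i, j})"
      using insert.hyps insert.prems by (intro nth_equalityI) (auto simp: word_def)
    then show ?case
      using insert word_pair[of j] by (simp add: add_codeword)
  qed
  have word_even: "word T \<in> C" if T: "T \<subseteq> block i" "even (card T)" for T
  proof -
    have finT: "finite T" using T fin finite_subset by blast
    show ?thesis
    proof (cases "i \<in> T")
      case True
      \<comment> \<open>Without \<open>i\<close> an odd set remains, and \<open>star\<close> puts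
        \<open>i\<close> back.\<close>
      then have "odd (card (T - {i}))"
        using T(2) finT card_Suc_Diff1[of T i] by (metis even_Suc)
      then show ?thesis
        using star[of "T - {i}"] finT T True by (auto simp: insert_absorb)
    next
      case False
      then show ?thesis using star[of T] finT T by auto
    qed
  qed
  show ?thesis
  proof (intro equalityI subsetI)
    fix w assume "w \<in> proj \<tau> p ` C"
    then obtain x where x: "x \<in> C" "w = proj \<tau> p x" by blast
    have w_nth: "w ! k = (if x ! (p ! k) = 0 then 0 else klein_a)" if "k < length p" for k
      using inv[OF x(1)] p_block[OF that] \<tau> that permutes_symbols_0[OF \<tau>(1)]
      by (auto simp: x(2) proj_def)
    \<comment> \<open>Position \<open>k\<close> of the projected word is coordinate
      \<open>p ! k\<close>, so counting a in \<open>w\<close> counts the nonzero entries of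
      \<open>x\<close> in the block.\<close>
    have "(!) p ` {k. k < length p \<and> w ! k = klein_a} = {j \<in> (!) p ` {..<length p}. x ! j \<noteq> 0}"
      using w_nth by (auto simp: zero_prod_def)
    then have "(!) p ` {k. k < length p \<and> w ! k = klein_a} = {j \<in> block i. x ! j \<noteq> 0}"
      using bij_betw_imp_surj_on[OF bij] by simp
    then have "bij_betw ((!) p) {k. k < length p \<and> w ! k = klein_a} {j \<in> block i. x ! j \<noteq> 0}"
      by (intro bij_betw_subset[OF bij]) auto
    from bij_betw_same_card[OF this] have "even (card {k. k < length p \<and> w ! k = klein_a})"
      using inv[OF x(1)] by simp
    moreover have "length w = length p" by (simp add: x(2) proj_def)
    moreover have "\<forall>y\<in>set w. y = 0 \<or> y = klein_a"
      unfolding all_set_conv_all_nth using w_nth \<open>length w = length p\<close> by simp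
    then have "set w \<subseteq> {0, klein_a}" by blast
    ultimately show "w \<in> delta (card (block i))"
      by (simp add: delta_def len)
  next
    fix w assume "w \<in> delta (card (block i))"
    then have w: "length w = length p" "set w \<subseteq> {0, klein_a}"
        "even (card {k. k < length p \<and> w ! k = klein_a})"
      by (auto simp: delta_def len)
    \<comment> \<open>The positions of a in \<open>w\<close>, moved back to coordinates of the
      block.\<close>
    define T where "T = (!) p ` {k. k < length p \<and> w ! k = klein_a}"
    have "card T = card {k. k < length p \<and> w ! k = klein_a}"
      unfolding T_def using bij
      by (intro card_image) (auto simp: bij_betw_def intro: inj_on_subset)
    then have "word T \<in> C"
      using w(3) p_block by (intro word_even) (auto simp: T_def)
    moreover have "proj \<tau> p (word T) = w"
    proof (rule nth_equalityI)
      fix k assume "k < length (proj \<tau> p (word T))"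
      then have k: "k < length p" by (simp add: proj_def)
      have "p ! k \<in> T \<longleftrightarrow> w ! k = klein_a"
        using k p(1) by (auto simp: T_def nth_eq_iff_index_eq)
      moreover have "w ! k \<in> set w"
        using w(1) k by simp
      then have "w ! k = 0 \<or> w ! k = klein_a"
        using w(2) by blast
      ultimately show "proj \<tau> p (word T) ! k = w ! k"
        using k p_block[OF k] block_less \<tau> permutes_symbols_0[OF \<tau>(1)]
        by (auto simp: proj_def word_def)
    qed (simp add: proj_def w(1))
    ultimately show "w \<in> proj \<tau> p ` C" by blast
  qed
qed

text \<open>The case split asks for two words of weight 2 that disagree at a common coordinate
  \<open>j\<close>. As \<open>block j\<close> is all of \<open>block i\<close>, a conflict at one
  coordinate settles the whole block.\<close>

lemma block_image:
  assumes "i \<in> covered"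
  shows "\<exists>p \<tau>. distinct p \<and> set p = block i \<and> (\<forall>j. \<tau> j permutes {klein_a, klein_b, klein_c}) \<and>
           ((\<exists>l\<ge>2. proj \<tau> p ` C = delta l) \<or> proj \<tau> p ` C = epsilon2)"
proof (cases "\<exists>j\<in>block i. \<exists>k l. \<exists>u\<in>C. \<exists>v\<in>C.
    supp u = {j, k} \<and> supp v = {j, l} \<and> j \<noteq> k \<and> j \<noteq> l \<and> u ! j \<noteq> v ! j")
  case True
  then obtain j k l u v where j: "j \<in> block i" "u \<in> C" "supp u = {j, k}" "v \<in> C" "supp v = {j, l}"
      "j \<noteq> k" "j \<noteq> l" "u ! j \<noteq> v ! j"
    by blast
  obtain \<tau> where "block j = {j, k}" "\<forall>i. \<tau> i permutes {klein_a, klein_b, klein_c}"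
      "proj \<tau> [j, k] ` C = epsilon2"
    using epsilon2_block[OF j(2-8)] by blast
  then show ?thesis
    using j block_eq[OF j(1)] by (intro exI[of _ "[j, k]"] exI[of _ \<tau>]) auto
next
  case False
  have cov: "block i \<subseteq> covered" using block_subset_covered[OF assms] .
  have fin: "finite (block i)"
    by (rule finite_subset[OF subset_trans[OF cov covered_subset]]) simp
  \<comment> \<open>Every coordinate of the block lies in the support of a word of weight 2, which
    supplies the symbol; in the absence of a conflict it does not depend on the word.\<close>
  have "\<forall>j\<in>block i. \<exists>a. a \<noteq> 0 \<and> (\<forall>u\<in>C. \<forall>k. supp u = {j, k} \<longrightarrow> j \<noteq> k \<longrightarrow> u ! j = a)"
  proof
    fix j assume j: "j \<in> block i"
    then obtain v l where v: "v \<in> C" "supp v = {j, l}" "j \<noteq> l"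
      using cov by (auto simp: covered_def joined_def)
    then have "v ! j \<noteq> 0" by (simp add: nth_supp)
    moreover have "\<forall>u\<in>C. \<forall>k. supp u = {j, k} \<longrightarrow> j \<noteq> k \<longrightarrow> u ! j = v ! j"
      using False j v by blast
    ultimately show "\<exists>a. a \<noteq> 0 \<and> (\<forall>u\<in>C. \<forall>k. supp u = {j, k} \<longrightarrow> j \<noteq> k \<longrightarrow> u ! j = a)"
      by blast
  qed
  from bchoice[OF this] obtain s where s: "\<forall>j\<in>block i. s j \<noteq> 0 \<and>
      (\<forall>u\<in>C. \<forall>k. supp u = {j, k} \<longrightarrow> j \<noteq> k \<longrightarrow> u ! j = s j)"
    by blast
  then have "\<forall>j\<in>block i. \<exists>t. t permutes {klein_a, klein_b, klein_c} \<and> t (s j) = klein_a"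
    using ex_symbol_permutation by simp
  from bchoice[OF this] obtain t where t: "\<forall>j\<in>block i.
      t j permutes {klein_a, klein_b, klein_c} \<and> t j (s j) = klein_a"
    by blast
  define \<tau> where "\<tau> j = (if j \<in> block i then t j else id)" for j
  have \<tau>: "\<tau> j permutes {klein_a, klein_b, klein_c}" for j
    using t permutes_id by (auto simp: \<tau>_def)
  obtain k where "joined i k" using assms by (auto simp: covered_def)
  then have "{i, k} \<subseteq> block i" "i \<noteq> k" by (auto simp: block_def joined_def)
  then have "card (block i) \<ge> 2"
    using card_mono[OF fin, of "{i, k}"] by simp
  moreover have "proj \<tau> (sorted_list_of_set (block i)) ` C = delta (card (block i))"
  proof (rule delta_block[OF assms])
    show "s j \<noteq> 0" if "j \<in> block i" for j using s that by blast
    show "u ! j = s j" if "j \<in> block i" "u \<in> C" "supp u = {j, k}" "j \<noteq> k" for j k u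
      using s that by blast
    show "\<tau> j (s j) = klein_a" if "j \<in> block i" for j using t that by (simp add: \<tau>_def)
  qed (use fin \<tau> in auto)
  ultimately show ?thesis
    using fin \<tau>
    by (intro exI[of _ "sorted_list_of_set (block i)"] exI[of _ \<tau>]) auto
qed

text \<open>The blocks partition the covered coordinates and the code splits along each, so the
  projections to blocks concatenate to a direct sum. The uncovered coordinates come last and carry
  the zero code.\<close>

lemma equivalent_direct_sum:
  "\<exists>Ds. (\<forall>D\<in>set Ds. (\<exists>l\<ge>2. D = delta l) \<or> D = epsilon2) \<and>
     equivalent_codes n C (direct_sum (direct_sums Ds) (zero_code (card (vanishing_coords n C))))"
proof -
  have fin: "finite covered" using covered_subset finite_subset by blast
  obtain bs where bs: "set bs = block ` covered" "distinct bs"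
    using finite_distinct_list[of "block ` covered"] fin by blast
  have "\<exists>p \<tau>. distinct p \<and> set p = B \<and> (\<forall>j. \<tau> j permutes {klein_a, klein_b, klein_c}) \<and>
           ((\<exists>l\<ge>2. proj \<tau> p ` C = delta l) \<or> proj \<tau> p ` C = epsilon2)"
    if "B \<in> block ` covered" for B
    using that block_image by blast
  then obtain P T where PT: "\<And>B. B \<in> block ` covered \<Longrightarrow> distinct (P B)"
      "\<And>B. B \<in> block ` covered \<Longrightarrow> set (P B) = B"
      "\<And>B j. B \<in> block ` covered \<Longrightarrow> T B j permutes {klein_a, klein_b, klein_c}"
      "\<And>B. B \<in> block ` covered \<Longrightarrow>
        (\<exists>l\<ge>2. proj (T B) (P B) ` C = delta l) \<or> proj (T B) (P B) ` C = epsilon2"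
    by metis
  \<comment> \<open>Blocks are disjoint, so the renamings chosen for each block combine into one
    family indexed by coordinates.\<close>
  define \<tau> where "\<tau> j = (if j \<in> covered then T (block j) j else id)" for j
  have \<tau>: "\<tau> j permutes {klein_a, klein_b, klein_c}" for j
    using PT(3) permutes_id by (auto simp: \<tau>_def)
  have image_eq: "proj \<tau> (P B) ` C = proj (T B) (P B) ` C" if B: "B \<in> block ` covered" for B
  proof -
    have "\<tau> j = T B j" if "j \<in> B" for j
      using B that block_eq block_subset_covered unfolding \<tau>_def by fastforce
    then show ?thesis
      using PT(2)[OF B] by (intro image_cong refl proj_cong) auto
  qed
  define q where "q = concat (map P bs)"
  define r where "r = sorted_list_of_set ({..<n} - covered)"
  have r: "distinct r" "set r = {..<n} - covered" "length r = card ({..<n} - covered)"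
    by (simp_all add: r_def)
  have "\<Union>(block ` covered) = covered"
    using block_subset_covered by (auto simp: block_def)
  then have q_set: "set q = covered"
    using bs(1) PT(2) by (simp add: q_def)
  have disj: "B \<inter> B' = {}" if "B \<in> block ` covered" "B' \<in> block ` covered" "B \<noteq> B'" for B B'
    using that block_eq by blast
  have q_distinct: "distinct q"
    unfolding q_def
  proof (rule distinct_concat)
    \<comment> \<open>The entries of \<open>P B\<close> form \<open>B\<close>, so distinct blocks
      give distinct lists.\<close>
    have "inj_on P (set bs)"
      by (rule inj_onI) (metis PT(2) bs(1))
    then show "distinct (map P bs)"
      using bs(2) by (simp add: distinct_map)
    show "set ys \<inter> set zs = {}" if "ys \<in> set (map P bs)" "zs \<in> set (map P bs)" "ys \<noteq> zs" for ys zs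
    proof -
      obtain B B' where B: "B \<in> block ` covered" "B' \<in> block ` covered" "ys = P B" "zs = P B'"
        using \<open>ys \<in> set (map P bs)\<close> \<open>zs \<in> set (map P bs)\<close> bs(1) by auto
      then have "B \<inter> B' = {}"
        using disj \<open>ys \<noteq> zs\<close> by metis
      then show ?thesis
        using PT(2) B by simp
    qed
  qed (use bs(1) PT(1) in auto)
  have "proj \<tau> q ` C = direct_sums (map (\<lambda>B. proj (T B) (P B) ` C) bs)"
  proof -
    have "proj \<tau> q ` C = direct_sums (map (\<lambda>p. proj \<tau> p ` C) (map P bs))"
      unfolding q_def
    proof (rule proj_concat_image[OF linear])
      fix p assume "p \<in> set (map P bs)"
      then obtain i where i: "i \<in> covered" "set p = block i"
        using bs(1) PT(2) by auto
      then show "splits C (set p)" by (simp add: splits_block)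
      show "set p \<subseteq> {..<n}"
        using i block_subset_covered covered_subset by blast
    qed (use q_distinct q_def in simp)
    also have "map (\<lambda>p. proj \<tau> p ` C) (map P bs) = map (\<lambda>B. proj (T B) (P B) ` C) bs"
      using image_eq bs(1) by simp
    finally show ?thesis .
  qed
  moreover have "proj \<tau> r ` C = zero_code (card (vanishing_coords n C))"
  proof -
    have "proj \<tau> r x = replicate (card (vanishing_coords n C)) 0" if "x \<in> C" for x
    proof (rule nth_equalityI)
      fix k assume "k < length (proj \<tau> r x)"
      then have "k < length r" by (simp add: proj_def)
      then show "proj \<tau> r x ! k = replicate (card (vanishing_coords n C)) 0 ! k"
        using r nth_mem[of k r] nth_uncovered[OF that] permutes_symbols_0[OF \<tau>]
        by (auto simp: proj_def vanishing_coords_eq)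
    qed (simp add: proj_def r vanishing_coords_eq)
    then show ?thesis
      using zero_codeword by (auto simp: zero_code_def image_iff)
  qed
  moreover have "splits C (set q)"
    using splits_UN[of covered C block] fin splits_block linear \<open>\<Union>(block ` covered) = covered\<close> q_set by simp
  then have "proj \<tau> (q @ r) ` C = direct_sum (proj \<tau> q ` C) (proj \<tau> r ` C)"
    using q_set r covered_subset by (intro proj_append_image[OF linear]) auto
  moreover have "equivalent_codes n C (proj \<tau> (q @ r) ` C)"
    using q_distinct q_set r covered_subset \<tau> by (intro equivalent_codes_proj) auto
  ultimately show ?thesis
    using PT(4) bs(1) by (intro exI[of _ "map (\<lambda>B. proj (T B) (P B) ` C) bs"]) auto
qed

end

theorem theorem5:
  fixes n :: nat and C :: "klein list set"
  assumes "linear_code n C" and "self_orthogonal n C"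
  shows "(\<exists>m l D. m + l = n \<and> linear_code m D \<and> self_orthogonal m D \<and>
            (\<forall>x\<in>D. wt x \<noteq> 1) \<and>
            equivalent_codes n C (direct_sum D (direct_sums (replicate l gamma1))))
       \<and> (C = generate (klein_space n) {x \<in> C. wt x = 2} \<longrightarrow>
            (\<exists>Ds. (\<forall>D\<in>set Ds. (\<exists>l\<ge>2. D = delta l) \<or> D = epsilon2) \<and>
                  equivalent_codes n C
                    (direct_sum (direct_sums Ds) (zero_code (card (vanishing_coords n C))))))"
proof (intro conjI impI)
  assume "C = generate (klein_space n) {x \<in> C. wt x = 2}"
  with assms interpret weight_two_code n C
    by unfold_locales
  show "\<exists>Ds. (\<forall>D\<in>set Ds. (\<exists>l\<ge>2. D = delta l) \<or> D = epsilon2) \<and>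
     equivalent_codes n C (direct_sum (direct_sums Ds) (zero_code (card (vanishing_coords n C))))"
    by (rule equivalent_direct_sum)
qed (rule split_off_gamma1[OF assms])

end
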